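(* Let $p$ be an odd prime and $a\in\mathbb{Z}_p$. If $f(0),f(1),\ldots,f(p-1)$ are $p$-integers (elements of $\mathbb{Z}_p$), then $$\sum_{k=0}^{p-1}\binom ak\binom{-1-a}k\left((-1)^{\langle a\rangle_p}f(k)-\sum_{m=0}^k\binom km(-1)^mf(m)\right)\equiv 0\pmod{p^2}.$$
   Context: $\mathbb{Z}_p$ denotes the set of rational $p$-integers, i.e. rational numbers whose denominator is not divisible by $p$; congruences are in $\mathbb{Z}_p$. For $a\in\mathbb{Z}_p$, $\langle a\rangle_p\in\{0,1,\ldots,p-1\}$ is the least nonnegative residue of $a$ modulo $p$. $\binom ak=a(a-1)\cdots(a-k+1)/k!$ (with $\binom a0=1$). *)

theory Defs
  imports Complex_Main "HOL-Computational_Algebra.Primes"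
begin

text \<open>The ring of rational \<open>p\<close>-integers (the localization of the integers at \<open>p\<close>);
  \<open>quotient_of\<close> yields the fraction in lowest terms with positive denominator.\<close>

definition p_integers :: "nat \<Rightarrow> rat set" where
  "p_integers p = {x. \<not> int p dvd snd (quotient_of x)}"

text \<open>Congruence modulo \<open>m\<close> in that ring: the quotient by \<open>m\<close> must again be a
  \<open>p\<close>-integer, as divisibility in the field of rationals would be trivial.\<close>

definition p_cong :: "nat \<Rightarrow> rat \<Rightarrow> rat \<Rightarrow> rat \<Rightarrow> bool" where
  "p_cong p x y m \<longleftrightarrow> (\<exists>z \<in> p_integers p. x - y = m * z)"

text \<open>For prime \<open>p\<close> and a \<open>p\<close>-integer \<open>a\<close> such an \<open>r\<close> exists, and the least one is
  below \<open>p\<close>.\<close>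

definition least_residue :: "nat \<Rightarrow> rat \<Rightarrow> nat" where
  "least_residue p a = (LEAST r. p_cong p a (of_nat r) (of_nat p))"

end

theory Submission
  imports Defs "HOL-Computational_Algebra.Polynomial"
    "HOL-Computational_Algebra.Formal_Power_Series" "HOL-Number_Theory.Cong"
begin

text \<open>
  Let \<open>r\<close> be the least residue of \<open>a\<close>, fix the sign at \<open>(- 1)\<^sup>r\<close>, and let \<open>D(x)\<close> be the
  sum in question as a function of \<open>x\<close> in place of \<open>a\<close>. Only the factorials \<open>k!\<close> with
  \<open>k < p\<close> occur as denominators, so \<open>D\<close> is a polynomial with p-integral coefficients. It
  has two exact roots that differ by p, namely \<open>r\<close> and \<open>r - p\<close>. Dividing by monic linear
  factors preserves p-integrality, so \<open>D(x) = (x - r) (x - r + p) Q(x)\<close> with \<open>Q\<close>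
  p-integral; at \<open>a = r + p t\<close> this equals \<open>p\<^sup>2 t (t + 1) Q(a)\<close>
  (\<open>p_integral_poly_double_root_cong\<close>).

  That \<open>r\<close> is a root holds for every natural number \<open>r < p\<close>: the sum then terminates
  by itself, and comparing the coefficients of each \<open>f(m)\<close> leaves a binomial identity
  that follows from Vandermonde's convolution (\<open>sum_gbinomial_pair_binomial\<close>). The
  second root comes from the first by the symmetry \<open>x \<mapsto> - 1 - x\<close> of \<open>D\<close>, which takes
  \<open>r - p\<close> to \<open>p - 1 - r\<close>; this has the parity of \<open>r\<close> since p is odd, so the fixed
  sign is the right one there too.
\<close>

section \<open>The ring of p-integers\<close>

lemma p_integers_iff_fraction:
  assumes "prime p"
  shows "x \<in> p_integers p \<longleftrightarrow> (\<exists>n d. x = of_int n / of_int d \<and> \<not> int p dvd d)"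
proof
  assume "x \<in> p_integers p"
  then have "\<not> int p dvd snd (quotient_of x)"
    by (simp add: p_integers_def)
  moreover have "x = of_int (fst (quotient_of x)) / of_int (snd (quotient_of x))"
    by (rule quotient_of_div) simp
  ultimately show "\<exists>n d. x = of_int n / of_int d \<and> \<not> int p dvd d"
    by blast
next
  assume "\<exists>n d. x = of_int n / of_int d \<and> \<not> int p dvd d"
  then obtain n d where x: "x = of_int n / of_int d" and d: "\<not> int p dvd d"
    by blast
  obtain n' d' where q: "quotient_of x = (n', d')"
    by (cases "quotient_of x")
  have d'pos: "d' > 0" and cop: "coprime n' d'" and x': "x = of_int n' / of_int d'"
    using q quotient_of_denom_pos quotient_of_coprime quotient_of_div by blast+
  have "d \<noteq> 0"
    using d by auto
  have "(of_int (n * d') :: rat) = of_int (n' * d)"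
    using x x' \<open>d \<noteq> 0\<close> d'pos by (simp add: field_simps)
  then have "n * d' = n' * d"
    using of_int_eq_iff by blast
  then have "d' dvd n' * d"
    by (metis dvd_triv_right)
  then have "d' dvd d"
    using cop by (simp add: coprime_commute coprime_dvd_mult_right_iff)
  then have "\<not> int p dvd d'"
    using d dvd_trans by blast
  then show "x \<in> p_integers p"
    by (simp add: p_integers_def q)
qed

lemma of_int_in_p_integers: "prime p \<Longrightarrow> of_int n \<in> p_integers p"
  using prime_gt_1_nat[of p] unfolding p_integers_iff_fraction
  by (intro exI[of _ n] exI[of _ 1]) simp

lemma of_nat_in_p_integers: "prime p \<Longrightarrow> of_nat n \<in> p_integers p"
  using of_int_in_p_integers[of p "int n"] by simp

lemma p_integers_mult:
  assumes "prime p" "x \<in> p_integers p" "y \<in> p_integers p"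
  shows "x * y \<in> p_integers p"
proof -
  obtain n d n' d' where "x = of_int n / of_int d" "\<not> int p dvd d"
      "y = of_int n' / of_int d'" "\<not> int p dvd d'"
    using assms by (auto simp: p_integers_iff_fraction)
  then have "x * y = of_int (n * n') / of_int (d * d')" "\<not> int p dvd d * d'"
    using \<open>prime p\<close> by (auto simp: prime_dvd_mult_iff)
  then show ?thesis
    using \<open>prime p\<close> p_integers_iff_fraction by blast
qed

lemma p_integers_add:
  assumes "prime p" "x \<in> p_integers p" "y \<in> p_integers p"
  shows "x + y \<in> p_integers p"
proof -
  obtain n d n' d' where xy: "x = of_int n / of_int d" "\<not> int p dvd d"
      "y = of_int n' / of_int d'" "\<not> int p dvd d'"
    using assms by (auto simp: p_integers_iff_fraction)
  then have "d \<noteq> 0" "d' \<noteq> 0"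
    by auto
  with xy have "x + y = of_int (n * d' + n' * d) / of_int (d * d')" "\<not> int p dvd d * d'"
    using \<open>prime p\<close> by (auto simp: prime_dvd_mult_iff field_simps)
  then show ?thesis
    using \<open>prime p\<close> p_integers_iff_fraction by blast
qed

lemma p_integers_uminus:
  assumes "prime p" "x \<in> p_integers p"
  shows "- x \<in> p_integers p"
  using p_integers_mult[OF \<open>prime p\<close> of_int_in_p_integers[OF \<open>prime p\<close>, of "- 1"] assms(2)] by simp

lemma p_integers_diff:
  assumes "prime p" "x \<in> p_integers p" "y \<in> p_integers p"
  shows "x - y \<in> p_integers p"
  using p_integers_add[OF assms(1,2) p_integers_uminus[OF assms(1,3)]] by simp

lemma p_integers_sum:
  assumes "prime p" "\<And>i. i \<in> A \<Longrightarrow> g i \<in> p_integers p"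
  shows "sum g A \<in> p_integers p"
  using assms(2) of_nat_in_p_integers[OF assms(1), of 0]
  by (induction A rule: infinite_finite_induct) (auto intro: p_integers_add[OF assms(1)])

lemma p_integers_power:
  assumes "prime p" "x \<in> p_integers p"
  shows "x ^ n \<in> p_integers p"
  using of_nat_in_p_integers[OF assms(1), of 1]
  by (induction n) (auto intro: p_integers_mult assms)

lemma inverse_fact_in_p_integers:
  assumes "prime p" "k < p"
  shows "1 / fact k \<in> p_integers p"
proof -
  have "\<not> int p dvd fact k"
    using assms by (metis linorder_not_less of_nat_dvd_iff of_nat_fact prime_dvd_fact_iff)
  then show ?thesis
    using p_integers_iff_fraction[OF \<open>prime p\<close>, of "1 / fact k"]
    by (metis of_int_1 of_int_fact)
qed

text \<open>The denominator of a p-integer is invertible modulo p, so the residue is that of the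
  numerator times this inverse.\<close>

lemma least_residue_props:
  assumes "prime p" "a \<in> p_integers p"
  shows "least_residue p a < p"
    and "p_cong p a (of_nat (least_residue p a)) (of_nat p)"
proof -
  obtain n d where a: "a = of_int n / of_int d" and d: "\<not> int p dvd d"
    using assms by (auto simp: p_integers_iff_fraction)
  have "coprime d (int p)"
    using d \<open>prime p\<close> by (metis coprime_commute prime_imp_coprime prime_nat_int_transfer)
  then obtain e where e: "[d * e = 1] (mod int p)"
    using cong_solve_coprime_int by blast
  define r where "r = nat (n * e mod int p)"
  have p0: "0 < int p"
    using \<open>prime p\<close> prime_gt_0_nat by simp
  then have r_int: "int r = n * e mod int p"
    by (simp add: r_def)
  then have "int r < int p"
    using p0 by simp
  then have "r < p"
    by simp
  have "[int r = n * e] (mod int p)"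
    by (simp add: r_int cong_def)
  then have "[int r * d = n * (d * e)] (mod int p)"
    by (metis cong_scalar_right mult.assoc mult.commute)
  also have "[n * (d * e) = n * 1] (mod int p)"
    using e by (rule cong_scalar_left)
  finally have "[n = int r * d] (mod int p)"
    by (simp add: cong_sym)
  then obtain z where z: "n - int r * d = int p * z"
    by (auto simp: cong_iff_dvd_diff dvd_def)
  have "d \<noteq> 0"
    using d by auto
  have "a - of_nat r = of_int (n - int r * d) / of_int d"
    using \<open>d \<noteq> 0\<close> by (simp add: a field_simps)
  also have "\<dots> = of_nat p * (of_int z / of_int d)"
    by (simp add: z)
  finally have "p_cong p a (of_nat r) (of_nat p)"
    unfolding p_cong_def using d p_integers_iff_fraction[OF \<open>prime p\<close>] by blast
  then show "p_cong p a (of_nat (least_residue p a)) (of_nat p)" "least_residue p a < p"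
    unfolding least_residue_def using \<open>r < p\<close>
    by (metis (mono_tags, lifting) LeastI, metis (mono_tags, lifting) Least_le order.strict_trans1)
qed

section \<open>Polynomials with p-integral coefficients\<close>

definition p_integral_poly :: "nat \<Rightarrow> rat poly \<Rightarrow> bool" where
  "p_integral_poly p q \<longleftrightarrow> (\<forall>i. coeff q i \<in> p_integers p)"

lemma p_integral_poly_pCons [simp]:
  "p_integral_poly p (pCons c q) \<longleftrightarrow> c \<in> p_integers p \<and> p_integral_poly p q"
  unfolding p_integral_poly_def
  by (metis coeff_pCons_0 coeff_pCons_Suc not0_implies_Suc)

lemma p_integral_poly_0: "prime p \<Longrightarrow> p_integral_poly p 0"
  using of_nat_in_p_integers[of p 0] by (simp add: p_integral_poly_def)

lemma p_integral_poly_mult: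
  "prime p \<Longrightarrow> p_integral_poly p q \<Longrightarrow> p_integral_poly p q' \<Longrightarrow> p_integral_poly p (q * q')"
  unfolding p_integral_poly_def by (auto simp: coeff_mult intro!: p_integers_sum p_integers_mult)

lemma p_integral_poly_smult:
  "prime p \<Longrightarrow> c \<in> p_integers p \<Longrightarrow> p_integral_poly p q \<Longrightarrow> p_integral_poly p (smult c q)"
  unfolding p_integral_poly_def by (auto intro!: p_integers_mult)

lemma p_integral_poly_sum:
  "prime p \<Longrightarrow> (\<And>i. i \<in> A \<Longrightarrow> p_integral_poly p (g i)) \<Longrightarrow> p_integral_poly p (sum g A)"
  unfolding p_integral_poly_def by (auto simp: coeff_sum intro!: p_integers_sum)

lemma p_integral_poly_prod:
  assumes "prime p" "\<And>i. i \<in> A \<Longrightarrow> p_integral_poly p (g i)"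
  shows "p_integral_poly p (prod g A)"
  using assms(2) of_nat_in_p_integers[OF assms(1), of 1] p_integral_poly_0[OF assms(1)]
  by (induction A rule: infinite_finite_induct)
    (auto simp: one_pCons intro: p_integral_poly_mult[OF assms(1)])

lemma poly_in_p_integers:
  assumes "prime p" "p_integral_poly p q" "c \<in> p_integers p"
  shows "poly q c \<in> p_integers p"
  using assms(2) of_nat_in_p_integers[OF assms(1), of 0]
  by (induction q) (auto intro!: p_integers_add p_integers_mult assms)

text \<open>Division by a monic linear factor needs no division of coefficients.\<close>

lemma p_integral_poly_synthetic_div:
  assumes "prime p" "p_integral_poly p q" "c \<in> p_integers p"
  shows "p_integral_poly p (synthetic_div q c)"
  using assms(2) p_integral_poly_0[OF assms(1)]
  by (induction q) (auto intro!: poly_in_p_integers assms)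

text \<open>The two roots split off two linear factors with a p-integral cofactor; at
  a point whose distance from both roots is divisible by p, each factor contributes one p.\<close>

lemma p_integral_poly_double_root_cong:
  assumes p: "prime p" and q: "p_integral_poly p q"
    and c: "c \<in> p_integers p" and x: "p_cong p x c (of_nat p)"
    and root1: "poly q c = 0" and root2: "poly q (c - of_nat p) = 0"
  shows "p_cong p (poly q x) 0 ((of_nat p)\<^sup>2)"
proof -
  define q1 where "q1 = synthetic_div q c"
  define q2 where "q2 = synthetic_div q1 (c - of_nat p)"
  have p0: "(of_nat p :: rat) \<noteq> 0"
    using p by auto
  have c': "c - of_nat p \<in> p_integers p"
    by (intro p_integers_diff p c of_nat_in_p_integers)
  have i1: "p_integral_poly p q1" and i2: "p_integral_poly p q2"
    unfolding q1_def q2_def by (intro p_integral_poly_synthetic_div p q c c')+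
  have e1: "q = [:- c, 1:] * q1"
    using synthetic_div_correct'[of c q] root1 by (simp add: q1_def)
  have "poly q1 (c - of_nat p) = 0"
    using root2 p0 by (simp add: e1)
  then have e2: "q1 = [:- (c - of_nat p), 1:] * q2"
    using synthetic_div_correct'[of "c - of_nat p" q1] by (simp add: q2_def)
  obtain t where t: "t \<in> p_integers p" "x - c = of_nat p * t"
    using x by (auto simp: p_cong_def)
  have x_eq: "x = c + of_nat p * t"
    using t(2) by (simp add: algebra_simps)
  have "poly q x = (x - c) * ((x - (c - of_nat p)) * poly q2 x)"
    by (subst e1, subst e2) (simp add: algebra_simps)
  also have "\<dots> = (of_nat p)\<^sup>2 * (t * ((t + 1) * poly q2 x))"
    by (simp add: x_eq power2_eq_square algebra_simps)
  finally have "poly q x - 0 = (of_nat p)\<^sup>2 * (t * ((t + 1) * poly q2 x))"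
    by simp
  moreover have "t * ((t + 1) * poly q2 x) \<in> p_integers p"
  proof -
    have "x \<in> p_integers p"
      unfolding x_eq by (intro p_integers_add p_integers_mult of_nat_in_p_integers p c t)
    moreover have "1 \<in> p_integers p"
      using of_nat_in_p_integers[OF p, of 1] by simp
    ultimately show ?thesis
      by (intro p_integers_add p_integers_mult poly_in_p_integers p i2 t)
  qed
  ultimately show ?thesis
    unfolding p_cong_def by blast
qed

section \<open>Binomial coefficients\<close>

text \<open>The coefficients have denominator \<open>(k!)\<^sup>2\<close>, which is prime to p as long as \<open>k < p\<close>.\<close>

lemma gbinomial_pair_p_integral_poly:
  assumes "prime p" "k < p"
  obtains q where "p_integral_poly p q"
    "\<And>x. poly q x = (x gchoose k) * ((- 1 - x) gchoose k)"
proof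
  let ?q = "smult (1 / fact k) (\<Prod>i = 0..<k. [:- of_nat i, 1:])
    * smult (1 / fact k) (\<Prod>i = 0..<k. [:- 1 - of_nat i, - 1:])"
  have "1 \<in> p_integers p" "- 1 \<in> p_integers p"
    using of_int_in_p_integers[OF \<open>prime p\<close>, of 1] of_int_in_p_integers[OF \<open>prime p\<close>, of "- 1"]
    by simp_all
  then show "p_integral_poly p ?q"
    using assms
    by (intro p_integral_poly_mult p_integral_poly_smult p_integral_poly_prod
        inverse_fact_in_p_integers)
      (auto intro!: p_integral_poly_0 p_integers_uminus p_integers_diff of_nat_in_p_integers)
  show "poly ?q x = (x gchoose k) * ((- 1 - x) gchoose k)" for x
    by (simp add: gbinomial_prod_rev poly_prod algebra_simps)
qed

text \<open>Trinomial revision extracts the factor \<open>r choose m\<close>, and what remains is a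
  Vandermonde convolution. The products \<open>(r gchoose k) * ((- 1 - r) gchoose k)\<close> are the
  coefficients of \<open>P\<^sub>r(1 - 2 y)\<close> in powers of \<open>y\<close>, for the Legendre polynomial \<open>P\<^sub>r\<close>, and
  the identity expresses the parity \<open>P\<^sub>r(- x) = (- 1)\<^sup>r P\<^sub>r(x)\<close>.\<close>

lemma sum_gbinomial_pair_binomial:
  fixes r m n :: nat
  assumes "r \<le> n"
  shows "(\<Sum>k\<le>n. of_nat (k choose m) * ((of_nat r gchoose k) * ((- 1 - of_nat r) gchoose k)))
    = (- 1) ^ (m + r) * ((of_nat r gchoose m) * ((- 1 - of_nat r :: rat) gchoose m))"
    (is "?S = _")
proof (cases "m \<le> r")
  case False
  then have "k choose m = 0 \<or> r choose k = 0" for k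
    by (cases "k < m") auto
  then have "?S = 0"
    by (intro sum.neutral) (auto simp flip: binomial_gbinomial)
  then show ?thesis
    using False by (simp flip: binomial_gbinomial)
next
  case True
  have "?S = (\<Sum>k\<le>r. of_nat (k choose m) * ((of_nat r gchoose k) * ((- 1 - of_nat r) gchoose k)))"
    using assms by (intro sum.mono_neutral_right) (auto simp flip: binomial_gbinomial)
  also have "\<dots> = of_nat (r choose m) *
      (\<Sum>k\<le>r. ((- 1 - of_nat r) gchoose k) * (of_nat (r - m) gchoose (r - k)))"
    unfolding sum_distrib_left
  proof (rule sum.cong[OF refl])
    fix k assume "k \<in> {..r}"
    then have "k \<le> r"
      by simp
    have "(r choose k) * (k choose m) = (r choose m) * ((r - m) choose (r - k))"
    proof (cases "m \<le> k")
      case True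
      then have "r - k = (r - m) - (k - m)" "k - m \<le> r - m"
        using \<open>k \<le> r\<close> by auto
      then show ?thesis
        using choose_mult[OF True \<open>k \<le> r\<close>] binomial_symmetric[of "k - m" "r - m"] by simp
    next
      case False
      then have "r - m < r - k" "k < m"
        using \<open>m \<le> r\<close> by linarith+
      then show ?thesis
        by (simp only: binomial_eq_0 mult_0_right)
    qed
    then have "of_nat (k choose m) * of_nat (r choose k)
        = (of_nat (r choose m) * of_nat ((r - m) choose (r - k)) :: rat)"
      by (metis mult.commute of_nat_mult)
    then show "of_nat (k choose m) * ((of_nat r gchoose k) * ((- 1 - of_nat r) gchoose k))
        = (of_nat (r choose m) * (((- 1 - of_nat r) gchoose k) * (of_nat (r - m) gchoose (r - k))) :: rat)"
      by (simp add: mult_ac flip: binomial_gbinomial)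
  qed
  also have "(\<Sum>k\<le>r. ((- 1 - of_nat r :: rat) gchoose k) * (of_nat (r - m) gchoose (r - k)))
      = (- 1 - of_nat m) gchoose r"
    using \<open>m \<le> r\<close> by (simp add: atMost_atLeast0 gbinomial_Vandermonde of_nat_diff)
  also have "\<dots> = (- 1) ^ r * of_nat ((m + r) choose r)"
    using gbinomial_minus[of "of_nat m + 1 :: rat" r]
    by (simp add: binomial_gbinomial algebra_simps)
  also have "of_nat ((m + r) choose r) = (- 1) ^ m * ((- 1 - of_nat r :: rat) gchoose m)"
    using gbinomial_minus[of "of_nat r + 1 :: rat" m] binomial_symmetric[of r "m + r"]
    by (simp add: binomial_gbinomial algebra_simps flip: power_mult_distrib power_add)
  finally show ?thesis
    by (simp add: binomial_gbinomial power_add mult_ac)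
qed

text \<open>After interchanging the two sums, both halves have the same coefficient at each
  \<open>f m\<close>, so the sum vanishes exactly, for arbitrary \<open>f\<close>.\<close>

lemma sum_gbinomial_pair_transform_eq_0:
  fixes r n :: nat and f :: "nat \<Rightarrow> rat"
  assumes "r \<le> n"
  shows "(\<Sum>k = 0..n. (of_nat r gchoose k) * ((- 1 - of_nat r) gchoose k) *
      ((- 1) ^ r * f k - (\<Sum>m = 0..k. of_nat (k choose m) * (- 1) ^ m * f m))) = 0"
proof -
  define g :: "nat \<Rightarrow> rat" where "g k = (of_nat r gchoose k) * ((- 1 - of_nat r) gchoose k)" for k
  have "(\<Sum>k = 0..n. g k * (\<Sum>m = 0..k. of_nat (k choose m) * (- 1) ^ m * f m))
      = (\<Sum>k\<le>n. g k * (\<Sum>m\<le>n. of_nat (k choose m) * (- 1) ^ m * f m))"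
    unfolding atMost_atLeast0
    by (intro sum.cong[OF refl] arg_cong[where f = "(*) _"] sum.mono_neutral_left) auto
  also have "\<dots> = (\<Sum>m\<le>n. (- 1) ^ m * f m * (\<Sum>k\<le>n. of_nat (k choose m) * g k))"
    unfolding sum_distrib_left by (subst sum.swap) (simp add: mult_ac)
  also have "\<dots> = (\<Sum>m\<le>n. (- 1) ^ m * f m * ((- 1) ^ (m + r) * g m))"
    unfolding g_def using assms
    by (intro sum.cong[OF refl] arg_cong[where f = "(*) _"] sum_gbinomial_pair_binomial) auto
  also have "\<dots> = (\<Sum>k = 0..n. g k * ((- 1) ^ r * f k))"
    unfolding atMost_atLeast0
    by (intro sum.cong[OF refl]) (simp add: power_add mult_ac flip: power_mult_distrib)
  finally show ?thesis
    by (simp add: g_def right_diff_distrib sum_subtractf)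
qed

section \<open>The congruence\<close>

theorem theorem2p4:
  fixes p :: nat and a :: rat and f :: "nat \<Rightarrow> rat"
  assumes "prime p" and "odd p"
    and "a \<in> p_integers p"
    and "\<And>k. k \<in> {0..p - 1} \<Longrightarrow> f k \<in> p_integers p"
  shows "p_cong p
    (\<Sum>k = 0..p - 1. (a gchoose k) * ((- 1 - a) gchoose k) *
      ((- 1) ^ least_residue p a * f k -
        (\<Sum>m = 0..k. of_nat (k choose m) * (- 1) ^ m * f m)))
    0 ((of_nat p)\<^sup>2)"
proof -
  define r where "r = least_residue p a"
  have r: "r < p" "p_cong p a (of_nat r) (of_nat p)"
    unfolding r_def using least_residue_props[OF assms(1,3)] by auto
  define c where "c k = (- 1) ^ r * f k - (\<Sum>m = 0..k. of_nat (k choose m) * (- 1) ^ m * f m)" for k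
  define D where "D x = (\<Sum>k = 0..p - 1. (x gchoose k) * ((- 1 - x) gchoose k) * c k)" for x :: rat
  have "p > 0"
    using r(1) by simp
  have c_int: "c k \<in> p_integers p" if "k \<in> {0..p - 1}" for k
  proof -
    have "- 1 \<in> p_integers p"
      using of_int_in_p_integers[OF assms(1), of "- 1"] by simp
    then show ?thesis
      unfolding c_def using that assms(1)
      by (intro p_integers_diff p_integers_sum p_integers_mult p_integers_power
          of_nat_in_p_integers assms(4)) auto
  qed
  have "\<exists>q. p_integral_poly p q \<and> (\<forall>x. poly q x = (x gchoose k) * ((- 1 - x) gchoose k))"
    if "k \<in> {0..p - 1}" for k
    using gbinomial_pair_p_integral_poly[OF assms(1), of k] that \<open>p > 0\<close>
    by (metis Suc_pred' atLeastAtMost_iff le_imp_less_Suc)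
  then obtain Q where Q: "\<And>k. k \<in> {0..p - 1} \<Longrightarrow> p_integral_poly p (Q k)"
      "\<And>k x. k \<in> {0..p - 1} \<Longrightarrow> poly (Q k) x = (x gchoose k) * ((- 1 - x) gchoose k)"
    by metis
  define q where "q = (\<Sum>k = 0..p - 1. smult (c k) (Q k))"
  have q_int: "p_integral_poly p q"
    unfolding q_def by (intro p_integral_poly_sum p_integral_poly_smult Q(1) c_int assms(1))
  have q_eval: "poly q x = D x" for x
    unfolding q_def D_def by (auto simp: poly_sum Q(2) mult_ac intro!: sum.cong)
  have root1: "D (of_nat r) = 0"
    unfolding D_def c_def using r(1) by (intro sum_gbinomial_pair_transform_eq_0) simp
  \<comment> \<open>The sum is symmetric under \<open>x \<mapsto> - 1 - x\<close>, which sends \<open>r - p\<close> to \<open>p - 1 - r\<close>,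
    again at most \<open>p - 1\<close>, and of the same parity as \<open>r\<close> because \<open>p\<close> is odd.\<close>
  have root2: "D (of_nat r - of_nat p) = 0"
  proof -
    define s where "s = p - 1 - r"
    have s: "of_nat r - of_nat p = (- 1 - of_nat s :: rat)"
      using r(1) by (simp add: s_def of_nat_diff)
    have "even (r + s)"
      using \<open>odd p\<close> r(1) by (simp add: s_def)
    then have sign: "(- 1 :: rat) ^ r = (- 1) ^ s"
      by (auto simp: minus_one_power_iff)
    have "D (of_nat r - of_nat p)
        = (\<Sum>k = 0..p - 1. (of_nat s gchoose k) * ((- 1 - of_nat s) gchoose k) * c k)"
      unfolding D_def s by (simp add: mult_ac)
    also have "\<dots> = 0"
      unfolding c_def sign by (intro sum_gbinomial_pair_transform_eq_0) (simp add: s_def)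
    finally show ?thesis .
  qed
  have "p_cong p (poly q a) 0 ((of_nat p)\<^sup>2)"
    using root1 root2
    by (intro p_integral_poly_double_root_cong[OF assms(1) q_int _ r(2)]
        of_nat_in_p_integers assms(1)) (simp_all add: q_eval)
  then show ?thesis
    unfolding q_eval D_def c_def r_def .
qed

end
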